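(* Let $1\le p\le\infty$, $n\ge1$ and $m\ge2$. Then $B(\mathbb{D}^n,\overline{B_p^m},1)=0$.
   Context: $\mathbb{D}^n=\{z\in\mathbb{C}^n:|z_k|<1,\ k=1,\dots,n\}$ is the unit polydisk. $\overline{B_p^m}=\{w\in\mathbb{C}^m:\|w\|_p\le1\}$ is the closed unit ball of $\mathbb{C}^m$ for the usual $\ell_p$-norm. Multi-indices: $\alpha\in\mathbb{N}_0^n$, $z^\alpha=z_1^{\alpha_1}\cdots z_n^{\alpha_n}$; $r\mathbb{D}^n=\{rz:z\in\mathbb{D}^n\}$. $B(\mathbb{D}^n,\overline{B_p^m},1)$ denotes the $\lambda$-second Bohr radius with $\lambda=1$ and the identity operator for functions with values in $\overline{B_p^m}\subset(\mathbb{C}^m,\|\cdot\|_p)$: it is the largest $r\ge0$ such that $$\sum_{\alpha\in\mathbb{N}_0^n}\ \sup_{z\in r\mathbb{D}^n}\|a_\alpha z^\alpha\|_p\ \le\ \sup_{z\in\mathbb{D}^n}\|f(z)\|_p$$ for every holomorphic $f:\mathbb{D}^n\to\overline{B_p^m}$ with power series expansion $f(z)=\sum_{\alpha\in\mathbb{N}_0^n}a_\alpha z^\alpha$, $a_\alpha\in\mathbb{C}^m$. *)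

theory Defs
  imports "HOL-Analysis.Analysis"
begin

definition polydisk :: "(complex ^ 'n) set" where
  "polydisk = {z. \<forall>k. cmod (z $ k) < 1}"

text \<open>The exponent \<open>p\<close> ranges over the extended reals; \<open>p = \<infinity>\<close> gives the maximum norm.\<close>

definition lp_norm :: "ereal \<Rightarrow> complex ^ 'm \<Rightarrow> real" where
  "lp_norm p w =
     (if p = \<infinity> then Max (range (\<lambda>i. cmod (w $ i)))
      else (\<Sum>i\<in>UNIV. cmod (w $ i) powr real_of_ereal p) powr (1 / real_of_ereal p))"

definition lp_cball :: "ereal \<Rightarrow> (complex ^ 'm) set" where
  "lp_cball p = {w. lp_norm p w \<le> 1}"

definition monomial_at :: "('n \<Rightarrow> nat) \<Rightarrow> complex ^ 'n \<Rightarrow> complex" where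
  "monomial_at \<alpha> z = (\<Prod>k\<in>UNIV. (z $ k) ^ \<alpha> k)"

text \<open>Holomorphy of a map between complex coordinate spaces: Frechet differentiability with a
  complex-linear derivative. (\<open>has_derivative\<close> alone only gives a real-linear one.)\<close>

definition holomorphic_map_on :: "(complex ^ 'n \<Rightarrow> complex ^ 'm) \<Rightarrow> (complex ^ 'n) set \<Rightarrow> bool" where
  "holomorphic_map_on f \<Omega> \<longleftrightarrow>
     (\<forall>z\<in>\<Omega>. \<exists>D. (f has_derivative D) (at z within \<Omega>) \<and> (\<forall>c v. D (c *s v) = c *s D v))"

definition power_series_expansion_on ::
    "(complex ^ 'n \<Rightarrow> complex ^ 'm) \<Rightarrow> (('n \<Rightarrow> nat) \<Rightarrow> complex ^ 'm) \<Rightarrow> (complex ^ 'n) set \<Rightarrow> bool" where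
  "power_series_expansion_on f a \<Omega> \<longleftrightarrow>
     (\<forall>z\<in>\<Omega>. ((\<lambda>\<alpha>. monomial_at \<alpha> z *s a \<alpha>) has_sum f z) UNIV)"

text \<open>\<open>N\<close> is the norm on the target space. Both sides of the inequality are taken in \<open>[0,\<infinity>]\<close>, so
  that a divergent series or an unbounded supremum has the value \<open>\<infinity>\<close>.\<close>

definition bohr_inequality ::
    "(complex ^ 'n) set \<Rightarrow> (complex ^ 'm) set \<Rightarrow> (complex ^ 'm \<Rightarrow> real) \<Rightarrow> real \<Rightarrow> bool" where
  "bohr_inequality \<Omega> W N r \<longleftrightarrow>
     (\<forall>f a. holomorphic_map_on f \<Omega> \<longrightarrow> f ` \<Omega> \<subseteq> W \<longrightarrow> power_series_expansion_on f a \<Omega> \<longrightarrow>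
        (\<Sum>\<^sub>\<infinity>\<alpha>\<in>UNIV. SUP z\<in>(\<lambda>z. r *\<^sub>R z) ` \<Omega>. ennreal (N (monomial_at \<alpha> z *s a \<alpha>)))
          \<le> (SUP z\<in>\<Omega>. ennreal (N (f z))))"

text \<open>If no largest \<open>r\<close> exists, the value of \<open>GREATEST\<close> is unspecified; thus an equation
  \<open>second_bohr_radius \<Omega> W N = r\<close> is only provable by showing that \<open>r\<close> is the maximum.\<close>

definition second_bohr_radius ::
    "(complex ^ 'n) set \<Rightarrow> (complex ^ 'm) set \<Rightarrow> (complex ^ 'm \<Rightarrow> real) \<Rightarrow> real" where
  "second_bohr_radius \<Omega> W N = (GREATEST r. 0 \<le> r \<and> bohr_inequality \<Omega> W N r)"

end

(* Perturb a constant map by a small linear term: for finite p take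
   f(z) = c (1 + e z_k, 1 - e z_k, 0, ...). Its supremum norm exceeds the norm of the constant term
   only by a factor 1 + O(e^2), because the first-order contributions of the two coordinates cancel,
   whereas the Bohr sum has the factor 1 + r e. So the inequality fails for every r > 0 once e is
   small. For p = infinity the map f(z) = (1, z_k, 0, ...) already works. *)

theory Submission imports Defs begin

lemma lp_norm_nonneg: "0 \<le> lp_norm p w"
proof (cases "p = \<infinity>")
  case True
  have "0 \<le> cmod (w $ undefined)" by simp
  also have "\<dots> \<le> Max (range (\<lambda>i. cmod (w $ i)))" by (rule Max_ge) auto
  finally show ?thesis using True by (simp add: lp_norm_def)
qed (simp add: lp_norm_def)

lemma lp_norm_zero [simp]: "lp_norm p 0 = 0"
  by (simp add: lp_norm_def)

lemma lp_norm_scale: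
  assumes "1 \<le> p"
  shows "lp_norm p (c *s w) = cmod c * lp_norm p w"
proof (cases p)
  case (real q)
  then have q: "1 \<le> q" using assms by (simp add: one_ereal_def)
  have "(\<Sum>i\<in>UNIV. cmod (c * w $ i) powr q) = cmod c powr q * (\<Sum>i\<in>UNIV. cmod (w $ i) powr q)"
    by (simp add: norm_mult powr_mult sum_distrib_left)
  then show ?thesis using real q
    by (simp add: lp_norm_def powr_mult powr_powr sum_nonneg)
next
  case PInf
  \<comment> \<open>Multiplication by \<open>cmod c\<close> is monotone, so it commutes with the
    finite maximum.\<close>
  have "mono (\<lambda>x. cmod c * x)" by (auto intro!: monoI mult_left_mono)
  then have "cmod c * Max (range (\<lambda>i. cmod (w $ i))) = Max ((\<lambda>x. cmod c * x) ` range (\<lambda>i. cmod (w $ i)))"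
    by (rule mono_Max_commute) auto
  then show ?thesis using PInf by (simp add: lp_norm_def norm_mult image_image)
qed (use assms in auto)

lemma monomial_at_zero_index [simp]: "monomial_at (\<lambda>_. 0) z = 1"
  by (simp add: monomial_at_def)

lemma monomial_at_unit_index: "monomial_at (\<lambda>i. if i = k then 1 else 0) z = z $ k"
proof -
  have "monomial_at (\<lambda>i. if i = k then 1 else 0) z = (\<Prod>i\<in>UNIV. if i = k then z $ i else 1)"
    unfolding monomial_at_def by (rule prod.cong) auto
  then show ?thesis by simp
qed

lemma monomial_at_origin:
  assumes "\<alpha> \<noteq> (\<lambda>_. 0)"
  shows "monomial_at \<alpha> 0 = 0"
proof -
  obtain k where "\<alpha> k \<noteq> 0" using assms by auto
  then show ?thesis by (auto simp: monomial_at_def)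
qed

text \<open>At radius 0 only the constant coefficient survives, and evaluating the series at the
  origin identifies it with \<open>f 0\<close>, whose norm is among those in the supremum. This
  makes 0 admissible, which is what lets \<open>GREATEST\<close> be attained.\<close>

lemma bohr_inequality_zero:
  fixes p :: ereal
  shows "bohr_inequality (polydisk :: (complex ^ 'n::finite) set) (lp_cball p :: (complex ^ 'm::finite) set)
           (lp_norm p) 0"
  unfolding bohr_inequality_def
proof (intro allI impI)
  fix f :: "complex ^ 'n \<Rightarrow> complex ^ 'm" and a
  assume exp: "power_series_expansion_on f a polydisk"
  have zero: "(0 :: complex ^ 'n) \<in> polydisk" by (simp add: polydisk_def)
  then have img: "(\<lambda>z. 0 *\<^sub>R z) ` (polydisk :: (complex ^ 'n) set) = {0}" by auto
  have "((\<lambda>\<alpha>. monomial_at \<alpha> 0 *s a \<alpha>) has_sum f 0) UNIV"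
    using exp zero by (auto simp: power_series_expansion_on_def)
  moreover have "((\<lambda>\<alpha>. monomial_at \<alpha> 0 *s a \<alpha>) has_sum a (\<lambda>_. 0)) UNIV"
    by (rule has_sum_finite_neutralI[of "{\<lambda>_. 0}"]) (auto simp: monomial_at_origin)
  ultimately have f0: "f 0 = a (\<lambda>_. 0)" by (rule has_sum_unique)
  have "((\<lambda>\<alpha>. ennreal (lp_norm p (monomial_at \<alpha> (0 :: complex ^ 'n) *s a \<alpha>))) has_sum
          ennreal (lp_norm p (a (\<lambda>_. 0)))) UNIV"
    by (rule has_sum_finite_neutralI[of "{\<lambda>_. 0}"]) (auto simp: monomial_at_origin)
  then have "(\<Sum>\<^sub>\<infinity>\<alpha>. ennreal (lp_norm p (monomial_at \<alpha> (0 :: complex ^ 'n) *s a \<alpha>))) =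
          ennreal (lp_norm p (f 0))"
    using f0 by (simp add: infsumI)
  also have "\<dots> \<le> (SUP z\<in>polydisk. ennreal (lp_norm p (f z)))"
    by (rule SUP_upper[OF zero])
  finally show "(\<Sum>\<^sub>\<infinity>\<alpha>. SUP z\<in>(\<lambda>z. 0 *\<^sub>R z) ` polydisk. ennreal (lp_norm p (monomial_at \<alpha> z *s a \<alpha>)))
      \<le> (SUP z\<in>polydisk. ennreal (lp_norm p (f z)))"
    unfolding img by simp
qed

text \<open>The map z -> u + z_k v has u and v as its only possibly nonzero coefficients, so its
  Bohr sum is ||u|| + r ||v||, while its values stay in the unit ball. Disproving the inequality at
  radius r thus becomes the search for two suitable vectors, independent of n.\<close>

lemma not_bohr_inequality_affine:
  fixes u v :: "complex ^ 'm::finite"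
  assumes p: "1 \<le> p" and r: "0 < r"
    and ball: "\<And>\<zeta>. cmod \<zeta> < 1 \<Longrightarrow> lp_norm p (u + \<zeta> *s v) \<le> 1"
    and large: "1 < lp_norm p u + r * lp_norm p v"
  shows "\<not> bohr_inequality (polydisk :: (complex ^ 'n::finite) set)
    (lp_cball p :: (complex ^ 'm) set) (lp_norm p) r"
proof
  assume bohr: "bohr_inequality (polydisk :: (complex ^ 'n) set) (lp_cball p :: (complex ^ 'm) set) (lp_norm p) r"
  \<comment> \<open>Any coordinate serves; \<open>undefined\<close> names one of them.\<close>
  define k :: 'n where "k = undefined"
  define \<alpha>\<^sub>0 \<alpha>\<^sub>1 :: "'n \<Rightarrow> nat" where "\<alpha>\<^sub>0 = (\<lambda>_. 0)" and "\<alpha>\<^sub>1 = (\<lambda>i. if i = k then 1 else 0)"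
  have neq: "\<alpha>\<^sub>0 \<noteq> \<alpha>\<^sub>1" by (auto simp: \<alpha>\<^sub>0_def \<alpha>\<^sub>1_def fun_eq_iff)
  define f where "f z = u + z $ k *s v" for z :: "complex ^ 'n"
  define a where "a \<alpha> = (if \<alpha> = \<alpha>\<^sub>0 then u else if \<alpha> = \<alpha>\<^sub>1 then v else 0)" for \<alpha>
  have m0: "monomial_at \<alpha>\<^sub>0 z = 1" and m1: "monomial_at \<alpha>\<^sub>1 z = z $ k" for z
    by (simp_all add: \<alpha>\<^sub>0_def \<alpha>\<^sub>1_def monomial_at_unit_index del: One_nat_def)
  \<comment> \<open>Real linearity yields the Frechet derivative; homogeneity over complex scalars
    is checked separately below.\<close>
  have "linear (\<lambda>h :: complex ^ 'n. h $ k *s v)"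
    by (rule linearI) (auto simp: vec_eq_iff algebra_simps)
  then have "(f has_derivative (\<lambda>h. h $ k *s v)) (at z within polydisk)" for z
    unfolding f_def by (auto intro!: derivative_eq_intros linear_imp_has_derivative)
  moreover have "(c *s h) $ k *s v = c *s (h $ k *s v)" for c and h :: "complex ^ 'n"
    by (simp add: vec_eq_iff)
  ultimately have hol: "holomorphic_map_on f polydisk"
    unfolding holomorphic_map_on_def by blast
  have f1: "lp_norm p (f z) \<le> 1" if "z \<in> polydisk" for z
    using that unfolding f_def by (intro ball) (auto simp: polydisk_def)
  then have maps: "f ` polydisk \<subseteq> lp_cball p" by (auto simp: lp_cball_def)
  have "((\<lambda>\<alpha>. monomial_at \<alpha> z *s a \<alpha>) has_sum f z) UNIV" for z
    by (rule has_sum_finite_neutralI[of "{\<alpha>\<^sub>0, \<alpha>\<^sub>1}"])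
       (use neq in \<open>auto simp: a_def m0 m1 f_def\<close>)
  then have exp: "power_series_expansion_on f a polydisk"
    by (simp add: power_series_expansion_on_def)
  define S where "S \<alpha> = (SUP z\<in>(\<lambda>z. r *\<^sub>R z) ` (polydisk :: (complex ^ 'n) set).
    ennreal (lp_norm p (monomial_at \<alpha> z *s a \<alpha>)))" for \<alpha>
  have u1: "lp_norm p u \<le> 1" using ball[of 0] by simp
  \<comment> \<open>Points of the scaled open polydisk satisfy |z_k| < r, so no single one yields
    the full value r ||v||. The strict inequality \<open>large\<close> leaves room for a smaller s
    with ||u|| + s > 1.\<close>
  then obtain s where s: "1 - lp_norm p u < s" "s < r * lp_norm p v"
    using dense[of "1 - lp_norm p u" "r * lp_norm p v"] large by auto
  have s0: "0 < s" using s(1) u1 by linarith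
  have v0: "0 < lp_norm p v"
    using s0 s(2) r by (smt (verit) mult_nonneg_nonpos)
  \<comment> \<open>With all coordinates equal to t, the linear term at \<open>r *\<^sub>R z\<close>
    has norm exactly s; t < 1 because s < r ||v||.\<close>
  define t where "t = s / (r * lp_norm p v)"
  have t: "0 < t" "t < 1" using s s0 v0 r by (auto simp: t_def field_simps)
  define z :: "complex ^ 'n" where "z = (\<chi> i. of_real t)"
  have z: "z \<in> polydisk" using t by (auto simp: z_def polydisk_def)
  have S: "ennreal (lp_norm p (monomial_at \<alpha> (r *\<^sub>R z) *s a \<alpha>)) \<le> S \<alpha>" for \<alpha>
    unfolding S_def by (rule SUP_upper) (use z in auto)
  have S0: "ennreal (lp_norm p u) \<le> S \<alpha>\<^sub>0"
    using S[of \<alpha>\<^sub>0] by (simp add: m0 a_def)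
  have S1: "ennreal s \<le> S \<alpha>\<^sub>1"
  proof -
    have "(r *\<^sub>R z) $ k = of_real (r * t)" unfolding vector_scaleR_component by (simp add: z_def scaleR_conv_of_real)
    moreover have "r * t * lp_norm p v = s" using r v0 by (simp add: t_def)
    ultimately have "lp_norm p ((r *\<^sub>R z) $ k *s v) = s"
      using r t by (simp only: lp_norm_scale[OF p] norm_of_real) (simp add: abs_mult)
    then show ?thesis using S[of \<alpha>\<^sub>1] neq by (simp add: m1 a_def)
  qed
  have "1 < ennreal (lp_norm p u + s)" using s by (simp add: ennreal_less_iff flip: ennreal_1)
  also have "\<dots> = ennreal (lp_norm p u) + ennreal s"
    using s0 by (simp add: lp_norm_nonneg)
  also have "\<dots> \<le> (\<Sum>\<alpha>\<in>{\<alpha>\<^sub>0, \<alpha>\<^sub>1}. S \<alpha>)"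
    using neq S0 S1 by (simp add: add_mono)
  \<comment> \<open>In [0,\<infinity>] the infinite sum is the supremum of its finite partial sums,
    so no summability argument arises.\<close>
  also have "\<dots> \<le> (\<Sum>\<^sub>\<infinity>\<alpha>. S \<alpha>)"
    by (subst nonneg_infsum_complete) (auto intro: SUP_upper)
  also have "\<dots> \<le> (SUP z\<in>polydisk. ennreal (lp_norm p (f z)))"
    using bohr hol maps exp unfolding bohr_inequality_def S_def by blast
  also have "\<dots> \<le> 1"
    by (rule SUP_least) (use f1 in \<open>simp add: ennreal_le_1\<close>)
  finally show False by simp
qed

text \<open>The imaginary part enters |1 + w|^2 only through its square, so to first order the
  modulus sees just Re w. After squaring, the slack contains e^2 (1 + 2 Re w), which is nonnegative
  because e \<le> 1/2.\<close>

lemma cmod_one_plus_le: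
  assumes "cmod w \<le> e" "0 < e" "e \<le> 1/2"
  shows "cmod (1 + w) \<le> 1 + Re w + e\<^sup>2"
proof (rule power2_le_imp_le)
  have w: "(Re w)\<^sup>2 + (Im w)\<^sup>2 \<le> e\<^sup>2"
    using power_mono[OF assms(1), of 2] by (simp add: cmod_power2)
  have x: "\<bar>Re w\<bar> \<le> e" using abs_Re_le_cmod[of w] assms by linarith
  then show "0 \<le> 1 + Re w + e\<^sup>2" using x assms(3) zero_le_power2[of e] by linarith
  have "0 \<le> e\<^sup>2 * (1 + 2 * Re w)" using x assms by (intro mult_nonneg_nonneg) auto
  moreover have "(1 + Re w + e\<^sup>2)\<^sup>2 = (1 + Re w)\<^sup>2 + e\<^sup>2 * (1 + 2 * Re w) + e\<^sup>2 + (e\<^sup>2)\<^sup>2"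
    by (simp add: power2_eq_square algebra_simps)
  ultimately have "(1 + Re w)\<^sup>2 + (Im w)\<^sup>2 \<le> (1 + Re w + e\<^sup>2)\<^sup>2"
    using w zero_le_power2[of "Re w"] zero_le_power2[of "e\<^sup>2"] by linarith
  then show "(cmod (1 + w))\<^sup>2 \<le> (1 + Re w + e\<^sup>2)\<^sup>2" by (simp add: cmod_power2)
qed

text \<open>The moduli are bounded by 1 + Re w + e^2 and 1 - Re w + e^2. Both bounds are convex
  combinations of the extreme values P and Q with swapped weights, so convexity of x^q bounds the
  two powers and the weights add up to 1.\<close>

lemma sum_powr_cmod_one_plus_minus_le:
  fixes q e :: real
  assumes q: "1 \<le> q" and w: "cmod w \<le> e" and e: "0 < e" "e \<le> 1/2"
  shows "cmod (1 + w) powr q + cmod (1 - w) powr q \<le> (1 + e + e\<^sup>2) powr q + (1 - e + e\<^sup>2) powr q"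
proof -
  define P Q where "P = 1 + e + e\<^sup>2" and "Q = 1 - e + e\<^sup>2"
  \<comment> \<open>The relative position of Re w in the interval [-e, e]: Re w = l e + (1 -
    l)(-e).\<close>
  define l where "l = (1 + Re w / e) / 2"
  have x: "\<bar>Re w\<bar> \<le> e" using abs_Re_le_cmod[of w] w by linarith
  have l: "0 \<le> l" "l \<le> 1" using x e by (auto simp: l_def field_simps abs_le_iff)
  have PQ: "0 < P" "0 < Q" using e by (auto simp: P_def Q_def add_pos_nonneg)
  have le: "e * (2 * l - 1) = Re w" using e by (simp add: l_def add_divide_distrib distrib_left)
  have "cmod (1 + w) \<le> 1 + Re w + e\<^sup>2" using cmod_one_plus_le[OF w e] .
  also have "\<dots> = l * P + (1 - l) * Q" unfolding le[symmetric] P_def Q_def by (simp add: algebra_simps)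
  finally have "cmod (1 + w) powr q \<le> (l * P + (1 - l) * Q) powr q"
    by (rule powr_mono2[rotated 2]) (use q in auto)
  also have "\<dots> \<le> l * P powr q + (1 - l) * Q powr q"
    using convex_onD[OF powr_convex[OF q], of l Q P] l PQ by (simp add: algebra_simps)
  finally have 1: "cmod (1 + w) powr q \<le> l * P powr q + (1 - l) * Q powr q" .
  have "cmod (1 - w) \<le> 1 - Re w + e\<^sup>2" using cmod_one_plus_le[of "- w" e] w e by simp
  also have "\<dots> = (1 - l) * P + l * Q" unfolding le[symmetric] P_def Q_def by (simp add: algebra_simps)
  finally have "cmod (1 - w) powr q \<le> ((1 - l) * P + l * Q) powr q"
    by (rule powr_mono2[rotated 2]) (use q in auto)
  also have "\<dots> \<le> (1 - l) * P powr q + l * Q powr q"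
    using convex_onD[OF powr_convex[OF q], of l P Q] l PQ by (simp add: algebra_simps)
  finally show ?thesis using 1 unfolding P_def[symmetric] Q_def[symmetric] by (simp add: algebra_simps)
qed

text \<open>Both sides equal 2 at e = 0. There the left side has derivative q - q = 0 and the right
  side 2 q r > 0, so the difference \<open>h\<close> is negative for small positive e.\<close>

lemma exists_perturbation_gain:
  fixes q r :: real
  assumes q: "1 \<le> q" and r: "0 < r"
  obtains e where "0 < e" "e \<le> 1/2"
    "(1 + e + e\<^sup>2) powr q + (1 - e + e\<^sup>2) powr q < 2 * (1 + r * e) powr q"
proof -
  define h where "h e = (1 + e + e\<^sup>2) powr q + (1 - e + e\<^sup>2) powr q - 2 * (1 + r * e) powr q" for e
  have "(h has_real_derivative - 2 * q * r) (at 0)"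
    unfolding h_def by (auto intro!: derivative_eq_intros)
  moreover have "- 2 * q * r < 0" using q r by simp
  ultimately obtain d where d: "d > 0" "\<And>x. 0 < x \<Longrightarrow> x < d \<Longrightarrow> h (0 + x) < h 0"
    using DERIV_neg_dec_right by blast
  have "h 0 = 0" by (simp add: h_def)
  \<comment> \<open>Halving d keeps the point strictly inside the range where \<open>h\<close> is
    negative; the cap 1/2 is the bound required by the modulus estimate.\<close>
  then show thesis using d(1) d(2)[of "min (d/2) (1/2)"]
    by (intro that[of "min (d/2) (1/2)"]) (auto simp: h_def)
qed

lemma lp_norm_two_coordinates:
  fixes i j :: "'m::finite"
  assumes "i \<noteq> j" and "0 < q"
  shows "lp_norm (ereal q) (axis i x + axis j y) = (cmod x powr q + cmod y powr q) powr (1 / q)"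
proof -
  have "(\<Sum>k\<in>UNIV. cmod ((axis i x + axis j y) $ k) powr q) =
      (\<Sum>k\<in>UNIV. (if k = i then cmod x powr q else 0) + (if k = j then cmod y powr q else 0))"
    using assms by (intro sum.cong) (auto simp: axis_def)
  then show ?thesis by (simp add: lp_norm_def sum.distrib)
qed

lemma exists_affine_witness:
  fixes p :: ereal
  assumes p: "1 \<le> p" and m: "CARD('m::finite) \<ge> 2" and r: "0 < r"
  obtains u v :: "complex ^ 'm" where
    "\<And>\<zeta>. cmod \<zeta> < 1 \<Longrightarrow> lp_norm p (u + \<zeta> *s v) \<le> 1" "1 < lp_norm p u + r * lp_norm p v"
proof -
  \<comment> \<open>Two distinct coordinates are what the opposite perturbations live on.\<close>
  obtain i j :: 'm where ij: "i \<noteq> j"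
    using m card_2_iff'[of "UNIV :: 'm set"]
    by (metis One_nat_def UNIV_I card_1_singleton_iff card_le_Suc0_iff_eq finite not_less_eq_eq numeral_2_eq_2)
  show thesis
  proof (cases p)
    case (real q)
    then have q: "1 \<le> q" using p by (simp add: one_ereal_def)
    obtain e where e: "0 < e" "e \<le> 1/2"
        and gain: "(1 + e + e\<^sup>2) powr q + (1 - e + e\<^sup>2) powr q < 2 * (1 + r * e) powr q"
      using exists_perturbation_gain[OF q r] .
    define M where "M = (1 + e + e\<^sup>2) powr q + (1 - e + e\<^sup>2) powr q"
    have "0 < 1 + e + e\<^sup>2" using e by (simp add: add_pos_pos)
    then have M: "0 < M" unfolding M_def by (intro add_pos_nonneg) auto
    \<comment> \<open>\<open>M powr (1 / q)\<close> bounds the norm of the unscaled map, so c is the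
      factor that brings its image into the unit ball.\<close>
    define c where "c = M powr (- 1 / q)"
    have c: "0 < c" using M by (simp add: c_def)
    have cM: "c * M powr (1 / q) = 1" using M by (simp add: c_def flip: powr_add)
    define u v :: "complex ^ 'm" where "u = of_real c *s (axis i 1 + axis j 1)"
      and "v = of_real (c * e) *s (axis i 1 + axis j (- 1))"
    show thesis
    proof (rule that[of u v])
      fix \<zeta> :: complex assume z: "cmod \<zeta> < 1"
      have w: "cmod (of_real e * \<zeta>) \<le> e" using z e by (simp add: norm_mult mult_left_le)
      have uv: "u + \<zeta> *s v = of_real c *s (axis i (1 + of_real e * \<zeta>) + axis j (1 - of_real e * \<zeta>))"
        by (auto simp: u_def v_def vec_eq_iff axis_def algebra_simps)
      have "lp_norm p (u + \<zeta> *s v) =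
          c * (cmod (1 + of_real e * \<zeta>) powr q + cmod (1 - of_real e * \<zeta>) powr q) powr (1 / q)"
        unfolding uv lp_norm_scale[OF p] using c q ij by (simp add: real lp_norm_two_coordinates)
      also have "\<dots> \<le> c * M powr (1 / q)"
        using sum_powr_cmod_one_plus_minus_le[OF q w e] c q
        by (intro mult_left_mono powr_mono2) (auto simp: M_def)
      finally show "lp_norm p (u + \<zeta> *s v) \<le> 1" using cM by simp
    next
      have "lp_norm p u + r * lp_norm p v = c * (2 powr (1 / q) * (1 + r * e))"
        unfolding u_def v_def lp_norm_scale[OF p] norm_of_real using c e q ij
        by (simp add: real lp_norm_two_coordinates abs_mult algebra_simps)
      \<comment> \<open>Moving 1 + r e under the q-th root gives the form that \<open>gain\<close>
        compares with M.\<close>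
      also have "2 powr (1 / q) * (1 + r * e) = (2 * (1 + r * e) powr q) powr (1 / q)"
        using q r e by (simp add: powr_mult powr_powr add_pos_pos)
      also have "c * \<dots> > c * M powr (1 / q)"
        using gain M q c by (intro mult_strict_left_mono powr_less_mono2) (auto simp: M_def)
      finally show "1 < lp_norm p u + r * lp_norm p v" using cM by simp
    qed
  next
    case PInf
    have N: "lp_norm \<infinity> (w :: complex ^ 'm) = Max (range (\<lambda>k. cmod (w $ k)))" for w
      by (simp add: lp_norm_def)
    have ax: "lp_norm \<infinity> (axis k 1 :: complex ^ 'm) = 1" for k
      unfolding N by (rule Max_eqI) (auto simp: axis_def intro: rev_image_eqI[of k])
    show thesis
    \<comment> \<open>For the maximum norm the second coordinate can vary in the unit disk without
      enlarging the norm beyond that of the first, so the Bohr sum is 1 + r at once.\<close>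
    proof (rule that[of "axis i 1" "axis j 1"])
      show "lp_norm p (axis i 1 + \<zeta> *s axis j 1 :: complex ^ 'm) \<le> 1" if "cmod \<zeta> < 1" for \<zeta>
        unfolding PInf N using that ij by (auto simp: axis_def)
      show "1 < lp_norm p (axis i 1 :: complex ^ 'm) + r * lp_norm p (axis j 1 :: complex ^ 'm)"
        unfolding PInf ax using r by simp
    qed
  qed (use p in auto)
qed

theorem theorem2p6:
  fixes p :: ereal
  assumes "1 \<le> p" and "CARD('m::finite) \<ge> 2"
  shows "second_bohr_radius (polydisk :: (complex ^ 'n::finite) set)
           (lp_cball p :: (complex ^ 'm) set) (lp_norm p) = 0"
  unfolding second_bohr_radius_def
proof (rule Greatest_equality)
  show "0 \<le> (0 :: real) \<and> bohr_inequality (polydisk :: (complex ^ 'n) set)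
      (lp_cball p :: (complex ^ 'm) set) (lp_norm p) 0"
    by (simp add: bohr_inequality_zero)
next
  fix r
  assume r: "0 \<le> r \<and> bohr_inequality (polydisk :: (complex ^ 'n) set)
      (lp_cball p :: (complex ^ 'm) set) (lp_norm p) r"
  \<comment> \<open>The witness is chosen after r: each positive radius is refuted by its own affine
    map.\<close>
  show "r \<le> 0"
  proof (rule ccontr)
    assume "\<not> r \<le> 0"
    then have "0 < r" by simp
    obtain u v :: "complex ^ 'm" where
      "\<And>\<zeta>. cmod \<zeta> < 1 \<Longrightarrow> lp_norm p (u + \<zeta> *s v) \<le> 1" "1 < lp_norm p u + r * lp_norm p v"
      using exists_affine_witness[OF assms \<open>0 < r\<close>] by metis
    then show False
      using not_bohr_inequality_affine[OF assms(1) \<open>0 < r\<close>, of u v] r by blast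
  qed
qed

end
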